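(* Let $X,Y$ be real Banach spaces, let $U\subseteq X$ be an open convex subset, and let $1\leq p<\infty$. If $f\in C^{1u}(U,Y)$, then the following assertions are equivalent: (i) $f\in C^{p}_{wsc}(U,Y)$; (ii) for every $U$-bounded and weakly $p$-Cauchy sequence $(x_n)_n$ in $U$ and every weakly $p$-Cauchy sequence $(h_n)_n\subset X$, the sequence $(f'(x_n)(h_n))_n$ converges in norm in $Y$; (iii) for every $U$-bounded weakly $p$-Cauchy sequence $(x_n)_n$ in $U$ and every weakly $p$-summable sequence $(h_n)_n\subset X$, we have $\lim_{n}\sup_{m}\|f'(x_m)(h_n)\|=0$; (iv) for every $U$-bounded and weakly $p$-Cauchy sequence $(x_n)_n$ in $U$ and every weakly $p$-summable sequence $(h_n)_n\subset X$, we have $\lim_{n} f'(x_n)(h_n)=0$; (v) $f'$ takes $U$-bounded and weakly $p$-precompact subsets of $U$ into uniformly $p$-convergent subsets of $L(X,Y)$.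
   Context: $L(X,Y)$ is the space of bounded linear operators $X\to Y$. A sequence $(x_n)_n$ in $X$ is weakly $p$-summable if $(x^*(x_n))_n\in\ell_p$ for every $x^*\in X^*$; $\ell_p^w(X)$ denotes the set of such sequences. A sequence $(x_n)_n$ is weakly $p$-Cauchy if $(x_{m_k}-x_{n_k})_k\in\ell_p^w(X)$ for all increasing sequences $(m_k)_k,(n_k)_k$ of positive integers. A subset of $X$ is weakly $p$-precompact if every sequence from it has a weakly $p$-Cauchy subsequence. A set $B\subset U$ is $U$-bounded if it is bounded and the distance between $B$ and the boundary of $U$ is strictly positive (this last condition is vacuous if $U=X$); a sequence is $U$-bounded if the set of its terms is. $C^{1u}(U,Y)$ is the space of all (Fréchet) differentiable mappings $f:U\to Y$ whose derivative $f':U\to L(X,Y)$ is uniformly continuous on $U$-bounded subsets of $U$. $C^{p}_{wsc}(U,Y)$ is the space of weakly $p$-sequentially continuous maps $f:U\to Y$, i.e. those taking $U$-bounded and weakly $p$-Cauchy sequences of $U$ into norm convergent sequences in $Y$. A set $K\subset L(X,Y)$ is uniformly $p$-convergent if $\lim_n\sup_{T\in K}\|T(x_n)\|=0$ for every $(x_n)_n\in\ell_p^w(X)$. *)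

theory Defs
  imports "HOL-Analysis.Analysis"
begin

definition weakly_p_summable :: "real \<Rightarrow> (nat \<Rightarrow> 'a::real_normed_vector) \<Rightarrow> bool" where
  "weakly_p_summable p x \<longleftrightarrow>
     (\<forall>\<phi> :: 'a \<Rightarrow>\<^sub>L real. summable (\<lambda>n. \<bar>blinfun_apply \<phi> (x n)\<bar> powr p))"

text \<open>The index sequences are strictly increasing; with constant ones allowed,
  only constant sequences would be weakly \<open>p\<close>-Cauchy.\<close>

definition weakly_p_Cauchy :: "real \<Rightarrow> (nat \<Rightarrow> 'a::real_normed_vector) \<Rightarrow> bool" where
  "weakly_p_Cauchy p x \<longleftrightarrow>
     (\<forall>m n :: nat \<Rightarrow> nat. strict_mono m \<longrightarrow> strict_mono n \<longrightarrow>
        weakly_p_summable p (\<lambda>k. x (m k) - x (n k)))"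

definition weakly_p_precompact :: "real \<Rightarrow> 'a::real_normed_vector set \<Rightarrow> bool" where
  "weakly_p_precompact p A \<longleftrightarrow>
     (\<forall>x :: nat \<Rightarrow> 'a. range x \<subseteq> A \<longrightarrow> (\<exists>r. strict_mono r \<and> weakly_p_Cauchy p (x \<circ> r)))"

text \<open>The distance to an empty set counts as infinite, whereas \<^const>\<open>setdist\<close> is \<open>0\<close> if one
  of its arguments is empty; hence the two guards. The frontier is empty for \<open>U = UNIV\<close>.\<close>

definition U_bounded :: "'a::real_normed_vector set \<Rightarrow> 'a set \<Rightarrow> bool" where
  "U_bounded U B \<longleftrightarrow> B \<subseteq> U \<and> bounded B \<and>
     (B \<noteq> {} \<longrightarrow> frontier U \<noteq> {} \<longrightarrow> 0 < setdist B (frontier U))"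

text \<open>The Frechet derivative as an element of the normed space of bounded linear operators;
  meaningful only at points of differentiability.\<close>

definition fderiv :: "('a::real_normed_vector \<Rightarrow> 'b::real_normed_vector) \<Rightarrow> 'a \<Rightarrow> 'a \<Rightarrow>\<^sub>L 'b" where
  "fderiv f x = Blinfun (frechet_derivative f (at x))"

lemma has_derivative_fderiv:
  assumes "f differentiable (at x)"
  shows "(f has_derivative blinfun_apply (fderiv f x)) (at x)"
proof -
  have d: "(f has_derivative frechet_derivative f (at x)) (at x)"
    using assms by (simp add: frechet_derivative_works)
  then show ?thesis
    by (simp add: fderiv_def bounded_linear_Blinfun_apply has_derivative_bounded_linear)
qed

text \<open>In the next two definitions maps on an open set \<open>U\<close> are represented by total functions;
  their values outside \<open>U\<close> are irrelevant.\<close>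

definition C1u :: "'a::real_normed_vector set \<Rightarrow> ('a \<Rightarrow> 'b::real_normed_vector) set" where
  "C1u U = {f. (\<forall>x\<in>U. f differentiable (at x)) \<and>
               (\<forall>B. U_bounded U B \<longrightarrow> uniformly_continuous_on B (fderiv f))}"

definition Cwsc :: "real \<Rightarrow> 'a::real_normed_vector set \<Rightarrow> ('a \<Rightarrow> 'b::real_normed_vector) set" where
  "Cwsc p U = {f. \<forall>x :: nat \<Rightarrow> 'a. U_bounded U (range x) \<longrightarrow> weakly_p_Cauchy p x \<longrightarrow>
                    convergent (\<lambda>n. f (x n))}"

text \<open>The supremum is taken in \<open>[0, \<infinity>]\<close>, so that it is \<open>0\<close> for empty \<open>K\<close> and \<open>\<infinity>\<close> if the norms
  are unbounded.\<close>

definition uniformly_p_convergent ::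
    "real \<Rightarrow> ('a::real_normed_vector \<Rightarrow>\<^sub>L 'b::real_normed_vector) set \<Rightarrow> bool" where
  "uniformly_p_convergent p K \<longleftrightarrow>
     (\<forall>x :: nat \<Rightarrow> 'a. weakly_p_summable p x \<longrightarrow>
        (\<lambda>n. SUP T\<in>K. ennreal (norm (blinfun_apply T (x n)))) \<longlonglongrightarrow> 0)"

end

(* A weakly p-Cauchy sequence is bounded, by the uniform boundedness principle in the Banach dual
   together with Hahn-Banach. (i) => (ii): for small t, uniform continuity of f' makes
   (f (x_n + t h_n) - f x_n) / t uniformly close to f' (x_n) (h_n), and for fixed t these quotients
   converge. (ii) => (iv): interleave h_n with zeros and repeat each x_n twice. (iv) => (i): if f x_n is
   not Cauchy, the mean value inequality yields points x_{n_k} + t_k (x_{m_k} - x_{n_k}), which are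
   again weakly p-Cauchy, at which f' is large on the weakly p-summable increments x_{m_k} - x_{n_k}.
   (iv) => (v) extracts a subsequence from a violation of uniformity, and (v) => (iii) holds because the
   range of a weakly p-Cauchy sequence is weakly p-precompact. *)

theory Submission
  imports Defs
begin

subsection \<open>Hahn-Banach and uniform boundedness\<close>

definition sublinear :: "('a::real_vector \<Rightarrow> real) \<Rightarrow> bool" where
  "sublinear q \<longleftrightarrow> (\<forall>x y. q (x + y) \<le> q x + q y) \<and> (\<forall>c x. 0 \<le> c \<longrightarrow> q (c *\<^sub>R x) = c * q x)"

lemma sublinear_add: "sublinear q \<Longrightarrow> q (x + y) \<le> q x + q y"
  and sublinear_scale: "sublinear q \<Longrightarrow> 0 \<le> c \<Longrightarrow> q (c *\<^sub>R x) = c * q x"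
  by (auto simp: sublinear_def)

lemma sublinear_zero: "sublinear q \<Longrightarrow> q 0 = 0"
  using sublinear_scale[of q 0 0] by simp

lemma sublinear_neg_le: "sublinear q \<Longrightarrow> - q (- x) \<le> q x"
  using sublinear_add[of q x "- x"] sublinear_zero[of q] by simp

text \<open>The standard device for Hahn-Banach without extension from subspaces. For sublinear
  \<open>q\<close> the tilt lies below \<open>q\<close> (take \<open>t = 0\<close>) and is at most
  \<open>- q y\<close> at \<open>- y\<close> (take \<open>t = 1\<close>), so every linear functional
  below the tilt agrees with \<open>q\<close> at \<open>y\<close>.\<close>

definition sublinear_tilt :: "('a::real_vector \<Rightarrow> real) \<Rightarrow> 'a \<Rightarrow> 'a \<Rightarrow> real" where
  "sublinear_tilt q y x = (INF t\<in>{0..}. q (x + t *\<^sub>R y) - t * q y)"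

text \<open>Since \<open>t * q y = q (t *\<^sub>R y)\<close>, subadditivity bounds this by
  \<open>q (- x) + q (x + t *\<^sub>R y)\<close>. The lower bound does not depend on
  \<open>t\<close>, so the real infimum is a genuine one.\<close>

lemma sublinear_tilt_bdd:
  assumes "sublinear q"
  shows "bdd_below ((\<lambda>t. q (x + t *\<^sub>R y) - t * q y) ` {0..})"
proof (rule bdd_belowI2)
  fix t :: real assume "t \<in> {0..}"
  then show "- q (- x) \<le> q (x + t *\<^sub>R y) - t * q y"
    using sublinear_add[OF assms, of "- x" "x + t *\<^sub>R y"] sublinear_scale[OF assms, of t y] by simp
qed

lemma sublinear_tilt_le:
  assumes "sublinear q" "0 \<le> t"
  shows "sublinear_tilt q y x \<le> q (x + t *\<^sub>R y) - t * q y"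
  unfolding sublinear_tilt_def using sublinear_tilt_bdd[OF assms(1)] assms(2) by (intro cINF_lower) auto

lemma sublinear_tilt_greatest:
  assumes "\<And>t. 0 \<le> t \<Longrightarrow> a \<le> q (x + t *\<^sub>R y) - t * q y"
  shows "a \<le> sublinear_tilt q y x"
  unfolding sublinear_tilt_def using assms by (intro cINF_greatest) auto

text \<open>Parameters \<open>t\<close> and \<open>s\<close> for the two summands combine to
  \<open>s + t\<close> for the sum, and the two infima are then taken one after the other. For
  homogeneity, one inequality for all positive \<open>c\<close> suffices: applied to
  \<open>inverse c\<close> it gives the other.\<close>

lemma sublinear_sublinear_tilt:
  assumes q: "sublinear q"
  shows "sublinear (sublinear_tilt q y)"
  unfolding sublinear_def
proof (intro conjI allI impI)
  fix a b
  have "sublinear_tilt q y (a + b) - (q (b + s *\<^sub>R y) - s * q y) \<le> q (a + t *\<^sub>R y) - t * q y"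
    if "0 \<le> s" "0 \<le> t" for s t
    using sublinear_tilt_le[OF q, of "s + t" y "a + b"] that
      sublinear_add[OF q, of "a + t *\<^sub>R y" "b + s *\<^sub>R y"]
    by (simp add: algebra_simps)
  then have "sublinear_tilt q y (a + b) - (q (b + s *\<^sub>R y) - s * q y) \<le> sublinear_tilt q y a"
    if "0 \<le> s" for s
    using that by (intro sublinear_tilt_greatest)
  then have "sublinear_tilt q y (a + b) - sublinear_tilt q y a \<le> sublinear_tilt q y b"
    by (intro sublinear_tilt_greatest) (simp add: algebra_simps)
  then show "sublinear_tilt q y (a + b) \<le> sublinear_tilt q y a + sublinear_tilt q y b" by simp
next
  have le: "sublinear_tilt q y (c *\<^sub>R x) \<le> c * sublinear_tilt q y x" if "0 < c" for c x
  proof -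
    have "sublinear_tilt q y (c *\<^sub>R x) / c \<le> sublinear_tilt q y x"
    proof (rule sublinear_tilt_greatest)
      fix t :: real assume "0 \<le> t"
      then have "sublinear_tilt q y (c *\<^sub>R x) \<le> q (c *\<^sub>R (x + t *\<^sub>R y)) - c * t * q y"
        using sublinear_tilt_le[OF q, of "c * t" y "c *\<^sub>R x"] that by (simp add: algebra_simps)
      also have "\<dots> = c * (q (x + t *\<^sub>R y) - t * q y)"
        using that sublinear_scale[OF q, of c "x + t *\<^sub>R y"] by (simp add: algebra_simps)
      finally show "sublinear_tilt q y (c *\<^sub>R x) / c \<le> q (x + t *\<^sub>R y) - t * q y"
        using that by (simp add: field_simps)
    qed
    then show ?thesis using that by (simp add: field_simps)
  qed
  fix c :: real and x assume "0 \<le> c"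
  show "sublinear_tilt q y (c *\<^sub>R x) = c * sublinear_tilt q y x"
  proof (cases "c = 0")
    case True
    have "sublinear_tilt q y 0 = 0"
    proof (rule antisym)
      show "sublinear_tilt q y 0 \<le> 0"
        using sublinear_tilt_le[OF q, of 0 y 0] sublinear_zero[OF q] by simp
      show "0 \<le> sublinear_tilt q y 0"
        by (rule sublinear_tilt_greatest) (simp add: sublinear_scale[OF q])
    qed
    with True show ?thesis by simp
  next
    case False
    with \<open>0 \<le> c\<close> have c: "0 < c" by simp
    have "c * sublinear_tilt q y x \<le> sublinear_tilt q y (c *\<^sub>R x)"
      using le[of "inverse c" "c *\<^sub>R x"] c by (simp add: field_simps)
    with le[OF c] show ?thesis by (intro antisym)
  qed
qed

text \<open>A minimal \<open>q\<close> coincides with each of its tilts, which gives superadditivity.\<close>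

lemma minimal_sublinear_is_linear:
  assumes q: "sublinear q"
    and min: "\<And>r. sublinear r \<Longrightarrow> (\<And>x. r x \<le> q x) \<Longrightarrow> r = q"
  shows "linear q"
proof -
  have tilt: "sublinear_tilt q y = q" for y
    using sublinear_tilt_le[OF q, of 0 y] by (intro min sublinear_sublinear_tilt q) simp
  have add: "q (x + y) = q x + q y" for x y
    using sublinear_tilt_le[OF q, of 1 y x] sublinear_add[OF q, of x y] tilt[of y] by simp
  have neg: "q (- x) = - q x" for x
    using add[of x "- x"] sublinear_zero[OF q] by simp
  show "linear q"
  proof (rule linearI)
    fix c x
    show "q (c *\<^sub>R x) = c *\<^sub>R q x"
    proof (cases "0 \<le> c")
      case False
      then show ?thesis
        using sublinear_scale[OF q, of "- c" x] neg[of "c *\<^sub>R x"] by simp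
    qed (simp add: sublinear_scale[OF q])
  qed (rule add)
qed

text \<open>Supplies the lower bound of a chain for Zorn's lemma. Subadditivity is where the chain
  matters: members \<open>r\<close> and \<open>s\<close> chosen for the two summands are replaced by
  a common smaller member \<open>u\<close>.\<close>

lemma sublinear_INF_chain:
  fixes C :: "('a::real_vector \<Rightarrow> real) set"
  assumes ne: "C \<noteq> {}" and sub: "\<And>r. r \<in> C \<Longrightarrow> sublinear r"
    and chain: "\<And>r s. r \<in> C \<Longrightarrow> s \<in> C \<Longrightarrow> r \<le> s \<or> s \<le> r"
    and bdd: "\<And>x. bdd_below ((\<lambda>r. r x) ` C)"
  shows "sublinear (\<lambda>x. INF r\<in>C. r x)"
  unfolding sublinear_def
proof (intro conjI allI impI)
  let ?m = "\<lambda>x. INF r\<in>C. r x"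
  have lower: "?m x \<le> r x" if "r \<in> C" for r x
    using that bdd by (intro cINF_lower)
  fix x y
  have "?m (x + y) - r x \<le> s y" if rs: "r \<in> C" "s \<in> C" for r s
  proof -
    obtain u where u: "u \<in> C" "u \<le> r" "u \<le> s"
      using chain[OF rs] rs by blast
    then show ?thesis
      using lower[OF u(1), of "x + y"] sublinear_add[OF sub[OF u(1)], of x y]
        le_funD[OF u(2), of x] le_funD[OF u(3), of y] by simp
  qed
  then have "?m (x + y) - r x \<le> ?m y" if "r \<in> C" for r
    using ne that by (intro cINF_greatest)
  then have "?m (x + y) - ?m y \<le> ?m x"
    using ne by (intro cINF_greatest) (simp_all add: algebra_simps)
  then show "?m (x + y) \<le> ?m x + ?m y" by simp
next
  let ?m = "\<lambda>x. INF r\<in>C. r x"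
  fix c :: real and x assume c: "0 \<le> c"
  have le: "?m (c *\<^sub>R x) \<le> c * ?m x" if c: "0 < c" for c x
  proof -
    have "?m (c *\<^sub>R x) / c \<le> ?m x"
    proof (rule cINF_greatest[OF ne])
      fix r assume r: "r \<in> C"
      have "?m (c *\<^sub>R x) \<le> r (c *\<^sub>R x)"
        using r bdd by (intro cINF_lower)
      then show "?m (c *\<^sub>R x) / c \<le> r x"
        using sublinear_scale[OF sub[OF r], of c x] c by (simp add: field_simps)
    qed
    then show ?thesis using c by (simp add: field_simps)
  qed
  show "?m (c *\<^sub>R x) = c * ?m x"
  proof (cases "c = 0")
    case True
    have "(\<lambda>r. r 0) ` C = {0}"
      using ne sublinear_zero[OF sub] by force
    with True show ?thesis by simp
  next
    case False
    with c have c: "0 < c" by simp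
    have "c * ?m x \<le> ?m (c *\<^sub>R x)"
      using le[of "inverse c" "c *\<^sub>R x"] c by (simp add: field_simps)
    with le[OF c] show ?thesis by (intro antisym)
  qed
qed

theorem Hahn_Banach_sublinear:
  assumes p: "sublinear p"
  obtains q where "linear q" "\<And>x. q x \<le> p x"
proof -
  define S where "S = {q. sublinear q \<and> q \<le> p}"
  \<comment> \<open>Zorn's lemma produces maximal elements, so it is applied to the reversed
    pointwise order.\<close>
  have "\<exists>m\<in>S. \<forall>r\<in>S. m \<ge> r \<longrightarrow> r = m"
  proof (rule predicate_Zorn)
    show "partial_order_on S (relation_of (\<lambda>x y. y \<le> x) S)"
      by (rule partial_order_on_relation_ofI) auto
    fix C assume C: "C \<in> Chains (relation_of (\<lambda>x y. y \<le> x) S)"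
    show "\<exists>u\<in>S. \<forall>r\<in>C. u \<le> r"
    proof (cases "C = {}")
      case True
      then show ?thesis using p by (auto simp: S_def)
    next
      case False
      have CS: "r \<in> S" if "r \<in> C" for r
        using C that by (force simp: Chains_def relation_of_def)
      have chain: "r \<le> s \<or> s \<le> r" if "r \<in> C" "s \<in> C" for r s
        using C that by (force simp: Chains_def relation_of_def)
      \<comment> \<open>All members lie below \<open>p\<close>, hence \<open>r x\<close> is at least
        \<open>- r (- x)\<close> and so at least \<open>- p (- x)\<close>, uniformly in
        \<open>r\<close>.\<close>
      have bdd: "bdd_below ((\<lambda>r. r x) ` C)" for x
      proof (rule bdd_belowI2)
        fix r assume "r \<in> C"
        then have "sublinear r" "r (- x) \<le> p (- x)"
          using CS by (auto simp: S_def le_fun_def)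
        then show "- p (- x) \<le> r x"
          using sublinear_neg_le[of r x] by simp
      qed
      have low: "(\<lambda>x. INF r\<in>C. r x) \<le> r" if "r \<in> C" for r
        using that bdd by (auto intro!: le_funI cINF_lower)
      have "sublinear (\<lambda>x. INF r\<in>C. r x)"
        using False CS chain bdd by (intro sublinear_INF_chain) (auto simp: S_def)
      moreover have "(\<lambda>x. INF r\<in>C. r x) \<le> p"
      proof -
        obtain r where "r \<in> C" using False by blast
        with low[OF this] CS[OF this] show ?thesis unfolding S_def by (auto intro: order_trans)
      qed
      ultimately show ?thesis
        using low by (intro bexI[of _ "\<lambda>x. INF r\<in>C. r x"]) (auto simp: S_def)
    qed
  qed
  then obtain m where m: "m \<in> S" "\<And>r. r \<in> S \<Longrightarrow> r \<le> m \<Longrightarrow> r = m" by blast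
  have "linear m"
  proof (rule minimal_sublinear_is_linear)
    show "sublinear m" using m(1) by (simp add: S_def)
    fix r :: "'a \<Rightarrow> real" assume "sublinear r" "\<And>x. r x \<le> m x"
    then show "r = m"
      using m(1) by (intro m(2)) (auto simp: S_def le_fun_def intro: order_trans)
  qed
  then show thesis using m(1) by (intro that[of m]) (auto simp: S_def le_fun_def)
qed

text \<open>A functional below the norm tilted by \<open>x\<close> takes a value at most \<open>- norm x\<close> at \<open>- x\<close>.\<close>

corollary exists_norming_functional:
  fixes x :: "'a::real_normed_vector"
  obtains \<phi> :: "'a \<Rightarrow>\<^sub>L real" where "norm \<phi> \<le> 1" "blinfun_apply \<phi> x = norm x"
proof -
  have n: "sublinear (norm :: 'a \<Rightarrow> real)"
    by (auto simp: sublinear_def norm_triangle_ineq)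
  obtain q where q: "linear q" "\<And>y. q y \<le> sublinear_tilt norm x y"
    using Hahn_Banach_sublinear[OF sublinear_sublinear_tilt[OF n]] by metis
  have le: "q y \<le> norm y" for y
    using q(2)[of y] sublinear_tilt_le[OF n, of 0 x y] by simp
  have neg: "q (- y) = - q y" for y
    using linear_neg[OF q(1)] by simp
  have abs: "\<bar>q y\<bar> \<le> norm y" for y
    using le[of y] le[of "- y"] neg[of y] by simp
  have "norm x \<le> q x"
    using q(2)[of "- x"] sublinear_tilt_le[OF n, of 1 x "- x"] neg[of x] by simp
  moreover have "bounded_linear q"
    using q(1) abs by (intro linear_conv_bounded_linear[THEN iffD1] bounded_linear_intro[of _ 1])
      (auto simp: linear_add linear_scale)
  ultimately show thesis
    using le[of x] abs
    by (intro that[of "Blinfun q"] norm_blinfun_bound) (auto simp: bounded_linear_Blinfun_apply)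
qed

text \<open>Baire category in the dual space, which is complete. The closed sets \<open>F k\<close>
  cover it, so one of them contains a ball; moving from its centre in the direction of a norming
  functional of \<open>x i\<close> bounds \<open>norm (x i)\<close>.\<close>

theorem weakly_bounded_imp_bounded:
  fixes x :: "'i \<Rightarrow> 'a::real_normed_vector"
  assumes "\<And>\<phi> :: 'a \<Rightarrow>\<^sub>L real. bounded (range (\<lambda>i. blinfun_apply \<phi> (x i)))"
  shows "bounded (range x)"
proof -
  define F where "F k = {\<phi> :: 'a \<Rightarrow>\<^sub>L real. \<forall>i. \<bar>blinfun_apply \<phi> (x i)\<bar> \<le> real k}" for k
  have cl: "closed (F k)" for k
    unfolding F_def by (intro closed_Collect_all closed_Collect_le continuous_intros)
  have cover: "\<Union>(range F) = UNIV"
  proof (intro equalityI subset_UNIV subsetI)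
    fix \<phi> :: "'a \<Rightarrow>\<^sub>L real"
    obtain B where "\<And>i. \<bar>blinfun_apply \<phi> (x i)\<bar> \<le> B"
      using assms[of \<phi>] by (auto simp: bounded_iff)
    moreover obtain k where "B \<le> real k" using real_arch_simple by blast
    ultimately show "\<phi> \<in> \<Union>(range F)"
      unfolding F_def by (auto intro: order_trans)
  qed
  have "\<exists>k. interior (F k) \<noteq> {}"
  proof (rule ccontr)
    assume "\<not> ?thesis"
    then have "euclidean interior_of \<Union>(range F) = {}"
      using cl by (intro Baire_category_alt disjI1 completely_metrizable_space_euclidean) auto
    then show False by (simp add: cover)
  qed
  then obtain k \<phi> where "\<phi> \<in> interior (F k)" by blast
  then obtain e where e: "0 < e" "cball \<phi> e \<subseteq> F k"
    by (meson mem_interior_cball)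
  have "norm (x i) \<le> 2 * real k / e" for i
  proof -
    obtain \<psi> :: "'a \<Rightarrow>\<^sub>L real" where psi: "norm \<psi> \<le> 1" "blinfun_apply \<psi> (x i) = norm (x i)"
      by (rule exists_norming_functional)
    \<comment> \<open>The values of these two functionals at \<open>x i\<close> differ by
      \<open>e * norm (x i)\<close>, and both have modulus at most \<open>k\<close>.\<close>
    have "\<phi> \<in> F k" "\<phi> + e *\<^sub>R \<psi> \<in> F k"
      using e psi(1) by (auto intro!: subsetD[OF e(2)] simp: dist_norm mult_left_le)
    then have "\<bar>blinfun_apply \<phi> (x i)\<bar> \<le> k" "\<bar>blinfun_apply \<phi> (x i) + e * norm (x i)\<bar> \<le> k"
      by (auto simp: F_def blinfun.add_left blinfun.scaleR_left simp flip: psi(2))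
    then have "e * norm (x i) \<le> 2 * real k" by linarith
    then show ?thesis using e(1) by (simp add: field_simps)
  qed
  then show ?thesis by (auto simp: bounded_iff)
qed

subsection \<open>Weakly $p$-summable and weakly $p$-Cauchy sequences\<close>

text \<open>A crude substitute for Minkowski's inequality is enough: the sum of two reals has
  modulus at most twice the larger modulus.\<close>

lemma weakly_p_summable_add:
  assumes "0 \<le> p" "weakly_p_summable p x" "weakly_p_summable p y"
  shows "weakly_p_summable p (\<lambda>n. x n + y n)"
  unfolding weakly_p_summable_def
proof
  fix \<phi> :: "'a \<Rightarrow>\<^sub>L real"
  have le: "\<bar>a + b\<bar> powr p \<le> 2 powr p * (\<bar>a\<bar> powr p + \<bar>b\<bar> powr p)" for a b :: real
  proof -
    have "\<bar>a + b\<bar> powr p \<le> (2 * max \<bar>a\<bar> \<bar>b\<bar>) powr p"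
      using \<open>0 \<le> p\<close> by (intro powr_mono2) auto
    also have "\<dots> = 2 powr p * max \<bar>a\<bar> \<bar>b\<bar> powr p"
      by (simp add: powr_mult)
    also have "\<dots> \<le> 2 powr p * (\<bar>a\<bar> powr p + \<bar>b\<bar> powr p)"
      by (intro mult_left_mono) (auto simp: max_def)
    finally show ?thesis .
  qed
  have "summable (\<lambda>n. 2 powr p * (\<bar>\<phi> (x n)\<bar> powr p + \<bar>\<phi> (y n)\<bar> powr p))"
    using assms by (intro summable_mult summable_add) (auto simp: weakly_p_summable_def)
  then show "summable (\<lambda>n. \<bar>\<phi> (x n + y n)\<bar> powr p)"
    by (rule summable_comparison_test') (simp add: blinfun.add_right le)
qed

text \<open>The factors may vary with the index; this is what intermediate points on segments of
  varying position require.\<close>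

lemma weakly_p_summable_scaleR:
  assumes "0 \<le> p" "weakly_p_summable p x" "\<And>n. \<bar>t n\<bar> \<le> C"
  shows "weakly_p_summable p (\<lambda>n. t n *\<^sub>R x n)"
  unfolding weakly_p_summable_def
proof
  fix \<phi> :: "'a \<Rightarrow>\<^sub>L real"
  have "summable (\<lambda>n. C powr p * \<bar>\<phi> (x n)\<bar> powr p)"
    using assms by (intro summable_mult) (auto simp: weakly_p_summable_def)
  then show "summable (\<lambda>n. \<bar>\<phi> (t n *\<^sub>R x n)\<bar> powr p)"
  proof (rule summable_comparison_test')
    fix n :: nat
    have "\<bar>t n\<bar> powr p \<le> C powr p"
      using assms by (intro powr_mono2) auto
    then show "norm (\<bar>\<phi> (t n *\<^sub>R x n)\<bar> powr p) \<le> C powr p * \<bar>\<phi> (x n)\<bar> powr p"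
      by (simp add: blinfun.scaleR_right abs_mult powr_mult mult_right_mono)
  qed
qed

lemma weakly_p_summable_diff:
  assumes "0 \<le> p" "weakly_p_summable p x" "weakly_p_summable p y"
  shows "weakly_p_summable p (\<lambda>n. x n - y n)"
  using weakly_p_summable_add[OF assms(1,2) weakly_p_summable_scaleR[OF assms(1,3), of "\<lambda>_. -1" 1]]
  by simp

lemma weakly_p_summable_reindex:
  assumes "weakly_p_summable p x" "inj r"
  shows "weakly_p_summable p (\<lambda>n. x (r n))"
  using assms summable_reindex[of "\<lambda>n. \<bar>blinfun_apply _ (x n)\<bar> powr p" r]
  by (simp add: weakly_p_summable_def o_def)

lemma weakly_p_summable_zero [simp]: "weakly_p_summable p (\<lambda>n. 0)"
  by (simp add: weakly_p_summable_def)

lemma weakly_p_summable_even_odd: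
  assumes "weakly_p_summable p (\<lambda>n. x (2 * n))" "weakly_p_summable p (\<lambda>n. x (2 * n + 1))"
  shows "weakly_p_summable p x"
  unfolding weakly_p_summable_def
proof
  fix \<phi> :: "'a \<Rightarrow>\<^sub>L real"
  let ?f = "\<lambda>n. \<bar>\<phi> (x n)\<bar> powr p"
  have "summable (\<lambda>n. ?f (2 * n))" "summable (\<lambda>n. ?f (2 * n + 1))"
    using assms by (auto simp: weakly_p_summable_def)
  then have "summable (\<lambda>n. if even n then ?f (2 * (n div 2)) else ?f (2 * ((n - 1) div 2) + 1))"
    \<comment> \<open>The first function handed to \<open>sums_if\<close> is the odd part, the
      second the even part.\<close>
    using sums_if[of "\<lambda>n. ?f (2 * n + 1)" _ "\<lambda>n. ?f (2 * n)"] by (meson summable_def)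
  moreover have "(if even n then ?f (2 * (n div 2)) else ?f (2 * ((n - 1) div 2) + 1)) = ?f n" for n
    by (cases "even n") (auto elim!: oddE)
  ultimately show "summable ?f" by simp
qed

text \<open>Each functional takes bounded values along the sequence, because the terms of a
  convergent series are bounded; uniform boundedness does the rest.\<close>

lemma weakly_p_summable_bounded:
  assumes "1 \<le> p" "weakly_p_summable p x"
  shows "bounded (range x)"
proof (rule weakly_bounded_imp_bounded)
  fix \<phi> :: "'a \<Rightarrow>\<^sub>L real"
  have "summable (\<lambda>n. \<bar>\<phi> (x n)\<bar> powr p)"
    using assms by (auto simp: weakly_p_summable_def)
  then obtain K where K: "\<bar>\<phi> (x n)\<bar> powr p \<le> K" for n
    using convergent_imp_Bseq[OF convergentI[OF summable_LIMSEQ_zero]] by (force simp: Bseq_def)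
  \<comment> \<open>Above 1 a value is dominated by its \<open>p\<close>-th power, as
    \<open>p\<close> is at least 1; below 1 nothing is to be shown.\<close>
  have "\<bar>\<phi> (x n)\<bar> \<le> max 1 K" for n
  proof (cases "\<bar>\<phi> (x n)\<bar> \<le> 1")
    case False
    then have "\<bar>\<phi> (x n)\<bar> powr 1 \<le> \<bar>\<phi> (x n)\<bar> powr p"
      using assms(1) by (intro powr_mono) auto
    with K[of n] False show ?thesis by simp
  qed simp
  then show "bounded (range (\<lambda>i. \<phi> (x i)))"
    by (auto simp: bounded_iff)
qed

section \<open>Weakly p-Cauchy sequences\<close>

lemma weakly_p_Cauchy_diff_summable:
  "weakly_p_Cauchy p x \<Longrightarrow> strict_mono m \<Longrightarrow> strict_mono n \<Longrightarrow>
    weakly_p_summable p (\<lambda>k. x (m k) - x (n k))"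
  by (simp add: weakly_p_Cauchy_def)

lemma weakly_p_summable_imp_Cauchy:
  assumes "0 \<le> p" "weakly_p_summable p x"
  shows "weakly_p_Cauchy p x"
  unfolding weakly_p_Cauchy_def
  using weakly_p_summable_diff[OF assms(1)] weakly_p_summable_reindex[OF assms(2)]
    strict_mono_imp_inj_on by blast

lemma weakly_p_Cauchy_const [simp]: "weakly_p_Cauchy p (\<lambda>n. c)"
  by (simp add: weakly_p_Cauchy_def)

lemma weakly_p_Cauchy_subseq:
  "weakly_p_Cauchy p x \<Longrightarrow> strict_mono r \<Longrightarrow> weakly_p_Cauchy p (\<lambda>n. x (r n))"
  by (simp add: weakly_p_Cauchy_def strict_mono_compose)

lemma weakly_p_Cauchy_add:
  assumes "0 \<le> p" "weakly_p_Cauchy p x" "weakly_p_Cauchy p y"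
  shows "weakly_p_Cauchy p (\<lambda>n. x n + y n)"
  unfolding weakly_p_Cauchy_def
proof (intro allI impI)
  fix m n :: "nat \<Rightarrow> nat" assume "strict_mono m" "strict_mono n"
  then have "weakly_p_summable p (\<lambda>k. (x (m k) - x (n k)) + (y (m k) - y (n k)))"
    using assms by (intro weakly_p_summable_add weakly_p_Cauchy_diff_summable)
  then show "weakly_p_summable p (\<lambda>k. x (m k) + y (m k) - (x (n k) + y (n k)))"
    by (simp add: algebra_simps)
qed

lemma weakly_p_Cauchy_scaleR:
  assumes "0 \<le> p" "weakly_p_Cauchy p x"
  shows "weakly_p_Cauchy p (\<lambda>n. c *\<^sub>R x n)"
  using assms
  by (auto simp: weakly_p_Cauchy_def simp flip: scaleR_diff_right
      intro!: weakly_p_summable_scaleR[where C = "\<bar>c\<bar>"])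

text \<open>Halving a strictly increasing index sequence may produce repetitions, but along every
  second position it stays strictly increasing. The differences are therefore summed separately over
  even and odd positions.\<close>

lemma weakly_p_Cauchy_div_2:
  assumes "weakly_p_Cauchy p x"
  shows "weakly_p_Cauchy p (\<lambda>n. x (n div 2))"
  unfolding weakly_p_Cauchy_def
proof (intro allI impI)
  have half: "strict_mono (\<lambda>k. r (2 * k + j) div 2)" if "strict_mono r" for r :: "nat \<Rightarrow> nat" and j
  proof (rule strict_mono_Suc_iff[THEN iffD2], rule allI)
    fix k
    \<comment> \<open>Two strict increases raise the index by at least 2, hence its half by at least
      1.\<close>
    have "r (2 * k + j) < r (2 * k + j + 1)" "r (2 * k + j + 1) < r (2 * k + j + 2)"
      using that by (simp_all add: strict_mono_less)
    then show "r (2 * k + j) div 2 < r (2 * Suc k + j) div 2" by simp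
  qed
  fix m n :: "nat \<Rightarrow> nat" assume mn: "strict_mono m" "strict_mono n"
  have "weakly_p_summable p (\<lambda>k. x (m (2 * k + j) div 2) - x (n (2 * k + j) div 2))" for j
    using assms mn by (intro weakly_p_Cauchy_diff_summable half)
  from this[of 0] this[of 1]
  show "weakly_p_summable p (\<lambda>k. x (m k div 2) - x (n k div 2))"
    by (intro weakly_p_summable_even_odd[of p "\<lambda>k. x (m k div 2) - x (n k div 2)"]) simp_all
qed

text \<open>In an unbounded sequence one can choose increasing indices \<open>m k\<close> so far out
  that \<open>x (m k) - x k\<close> has norm above \<open>k\<close>. Comparing \<open>m\<close> with
  the identity index sequence shows these differences to be weakly \<open>p\<close>-summable, hence
  bounded.\<close>

lemma weakly_p_Cauchy_bounded:
  assumes "1 \<le> p" "weakly_p_Cauchy p x"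
  shows "bounded (range x)"
proof (rule ccontr)
  assume unb: "\<not> bounded (range x)"
  have large: "\<exists>m>n. B < norm (x m)" for n B
  proof (rule ccontr)
    assume "\<not> ?thesis"
    then have "bounded (x ` {n<..})" by (auto simp: bounded_iff dest: leD intro!: exI[of _ B])
    moreover have "bounded (x ` {..n})" by (simp add: finite_imp_bounded)
    moreover have "range x = x ` {n<..} \<union> x ` {..n}" by (auto simp flip: image_Un simp: not_le)
    ultimately show False using unb by simp
  qed
  have "\<exists>m. \<forall>k. norm (x k) + k < norm (x (m k)) \<and> m k < m (Suc k)"
    using large[of _ "norm (x _) + real _"]
    by (intro dependent_nat_choice[where P = "\<lambda>k m. norm (x k) + real k < norm (x m)"]) blast+
  then obtain m where m: "norm (x k) + k < norm (x (m k))" "m k < m (Suc k)" for k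
    by blast
  have "weakly_p_summable p (\<lambda>k. x (m k) - x k)"
    using assms(2) m(2) by (intro weakly_p_Cauchy_diff_summable) (auto simp: strict_mono_Suc_iff)
  then obtain K where K: "norm (x (m k) - x k) \<le> K" for k
    using weakly_p_summable_bounded[OF assms(1)] by (auto simp: bounded_iff)
  obtain k where "K < real k" using reals_Archimedean2 by blast
  moreover have "real k < norm (x (m k) - x k)"
    using m(1)[of k] norm_triangle_ineq2[of "x (m k)" "x k"] by simp
  ultimately show False using K[of k] by simp
qed

text \<open>If \<open>g\<close> is unbounded on every tail, larger values can be picked
  successively; otherwise \<open>g\<close> takes finitely many values on some tail and the
  pigeonhole principle gives one taken infinitely often.\<close>

lemma nat_seq_subseq_const_or_strict_mono:
  fixes g :: "nat \<Rightarrow> nat"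
  obtains r :: "nat \<Rightarrow> nat" where "strict_mono r" "strict_mono (\<lambda>k. g (r k))"
  | r :: "nat \<Rightarrow> nat" and a where "strict_mono r" "\<And>k. g (r k) = a"
proof (cases "\<forall>n N. \<exists>n'>n. N < g n'")
  case True
  then have "\<exists>r. \<forall>k. True \<and> r k < r (Suc k) \<and> g (r k) < g (r (Suc k))"
    by (intro dependent_nat_choice[where P = "\<lambda>_ _. True"]) blast+
  then obtain r where "\<And>k. r k < r (Suc k)" "\<And>k. g (r k) < g (r (Suc k))"
    by blast
  then have "strict_mono r" "strict_mono (\<lambda>k. g (r k))"
    by (simp_all add: strict_mono_Suc_iff)
  then show thesis by (rule that(1))
next
  case False
  then obtain n N where *: "\<And>n'. n < n' \<Longrightarrow> \<not> N < g n'" by blast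
  have "g ` {n<..} \<subseteq> {..N}"
    using * by (fastforce simp: not_less)
  then have "finite (g ` {n<..})" by (rule finite_subset) simp
  then obtain a where inf: "infinite {k \<in> {n<..}. g k = g a}"
    using pigeonhole_infinite[of "{n<..}" g] infinite_Ioi by blast
  obtain r :: "nat \<Rightarrow> nat" where r: "strict_mono r" "\<And>k. r k \<in> {k \<in> {n<..}. g k = g a}"
    using infinite_enumerate[OF inf] by blast
  then show thesis by (intro that(2)[of r "g a"]) auto
qed

text \<open>A sequence from the range may visit the terms in any order and repeat them. After the
  dichotomy for its indices it contains either a subsequence of \<open>x\<close> or a constant
  sequence.\<close>

lemma weakly_p_Cauchy_range_precompact:
  assumes "weakly_p_Cauchy p x"
  shows "weakly_p_precompact p (range x)"
  unfolding weakly_p_precompact_def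
proof (intro allI impI)
  fix y :: "nat \<Rightarrow> 'a" assume "range y \<subseteq> range x"
  then have "\<forall>n. \<exists>k. y n = x k" by blast
  then obtain g where g: "\<And>n. y n = x (g n)" by metis
  have comp: "y \<circ> r = (\<lambda>k. x (g (r k)))" for r :: "nat \<Rightarrow> nat" by (simp add: fun_eq_iff g)
  show "\<exists>r. strict_mono r \<and> weakly_p_Cauchy p (y \<circ> r)"
  proof (cases rule: nat_seq_subseq_const_or_strict_mono[of g])
    case (1 r)
    then show ?thesis
      unfolding comp using weakly_p_Cauchy_subseq[OF assms 1(2)] by blast
  next
    case (2 r a)
    then show ?thesis
      unfolding comp by (intro exI[of _ r]) (simp add: weakly_p_Cauchy_const)
  qed
qed
subsection \<open>Bounded subsets away from the boundary\<close>

text \<open>Replaces the distance to the frontier by one radius valid at all points, which also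
  absorbs the case of an empty frontier.\<close>

lemma U_bounded_iff:
  fixes U :: "'a::real_normed_vector set"
  assumes "open U"
  shows "U_bounded U B \<longleftrightarrow> bounded B \<and> (\<exists>d>0. \<forall>x\<in>B. ball x d \<subseteq> U)"
proof
  assume B: "U_bounded U B"
  have "\<exists>d>0. \<forall>x\<in>B. ball x d \<subseteq> U"
  proof (cases "B = {} \<or> frontier U = {}")
    case True
    then show ?thesis
      using B by (auto simp: U_bounded_def frontier_eq_empty intro: exI[of _ 1])
  next
    case False
    have "ball x (setdist B (frontier U)) \<subseteq> U" if "x \<in> B" for x
    proof (rule ccontr)
      assume not: "\<not> ?thesis"
      let ?S = "ball x (setdist B (frontier U))"
      have "x \<in> ?S \<inter> U" using that B False by (auto simp: U_bounded_def)
      \<comment> \<open>A ball is connected, so if it meets both \<open>U\<close> and its complement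
        it meets the frontier.\<close>
      then have "?S \<inter> frontier U \<noteq> {}"
        using not by (intro connected_Int_frontier[OF connected_ball]) blast+
      then obtain y where "y \<in> frontier U" "dist x y < setdist B (frontier U)" by auto
      with setdist_le_dist[OF that this(1)] show False by simp
    qed
    moreover have "0 < setdist B (frontier U)" using B False by (auto simp: U_bounded_def)
    ultimately show ?thesis by blast
  qed
  then show "bounded B \<and> (\<exists>d>0. \<forall>x\<in>B. ball x d \<subseteq> U)"
    using B by (simp add: U_bounded_def)
next
  assume B: "bounded B \<and> (\<exists>d>0. \<forall>x\<in>B. ball x d \<subseteq> U)"
  then obtain d where d: "0 < d" "\<And>x. x \<in> B \<Longrightarrow> ball x d \<subseteq> U" by blast
  have "d \<le> setdist B (frontier U)" if "B \<noteq> {}" "frontier U \<noteq> {}"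
  proof (rule le_setdistI[OF that])
    fix x y assume "x \<in> B" "y \<in> frontier U"
    then have "y \<notin> ball x d"
      using d(2)[of x] assms by (auto simp: frontier_def interior_open)
    then show "d \<le> dist x y" by simp
  qed
  with B d show "U_bounded U B"
    unfolding U_bounded_def by (force intro: less_le_trans)
qed

lemma U_bounded_subset: "open U \<Longrightarrow> U_bounded U B \<Longrightarrow> A \<subseteq> B \<Longrightarrow> U_bounded U A"
  by (auto simp: U_bounded_iff intro: bounded_subset)

lemma U_bounded_imp_subset: "U_bounded U B \<Longrightarrow> B \<subseteq> U"
  by (simp add: U_bounded_def)

text \<open>The available radius is split in two halves: one for the enlargement, one for the
  distance that remains.\<close>

lemma U_bounded_enlarge:
  assumes "open U" "U_bounded U B"
  obtains d where "0 < d" "U_bounded U (\<Union>x\<in>B. cball x d)"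
proof -
  obtain d where d: "0 < d" "\<And>x. x \<in> B \<Longrightarrow> ball x d \<subseteq> U"
    using assms by (auto simp: U_bounded_iff)
  obtain M where M: "\<And>x. x \<in> B \<Longrightarrow> norm x \<le> M"
    using assms by (auto simp: U_bounded_def bounded_iff)
  have "norm y \<le> M + d / 2" if "x \<in> B" "y \<in> cball x (d / 2)" for x y
    using M[OF that(1)] that(2) norm_triangle_sub[of y x] by (auto simp: dist_norm norm_minus_commute)
  moreover have "ball y (d / 2) \<subseteq> U" if "x \<in> B" "y \<in> cball x (d / 2)" for x y
  proof -
    have "ball y (d / 2) \<subseteq> ball x d"
    proof
      fix z assume "z \<in> ball y (d / 2)"
      with that(2) show "z \<in> ball x d"
        using dist_triangle[of x z y] by auto
    qed
    with d(2)[OF that(1)] show ?thesis by blast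
  qed
  ultimately have "bounded (\<Union>x\<in>B. cball x (d / 2))"
    and "\<forall>y \<in> \<Union>x\<in>B. cball x (d / 2). ball y (d / 2) \<subseteq> U"
    unfolding bounded_iff by blast+
  then have "U_bounded U (\<Union>x\<in>B. cball x (d / 2))"
    using assms(1) d(1) by (metis U_bounded_iff half_gt_zero)
  with d(1) show thesis by (intro that[of "d / 2"]) auto
qed

text \<open>For \<open>norm v < d\<close> the translate of \<open>U\<close> by \<open>- v\<close> is
  convex and contains \<open>B\<close>, hence contains the hull. So the same radius \<open>d\<close>
  serves for the hull.\<close>

lemma U_bounded_convex_hull:
  assumes "open U" "convex U" "U_bounded U B"
  shows "U_bounded U (convex hull B)"
proof -
  obtain d where d: "0 < d" "\<And>x. x \<in> B \<Longrightarrow> ball x d \<subseteq> U"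
    using assms by (auto simp: U_bounded_iff)
  have "x + v \<in> U" if "norm v < d" "x \<in> convex hull B" for x v
  proof -
    have "convex ((\<lambda>y. y - v) ` U)"
      using assms(2) by (rule convex_translation_subtract)
    moreover have "B \<subseteq> (\<lambda>y. y - v) ` U"
    proof
      fix y assume "y \<in> B"
      then have "y + v \<in> U" using d(2)[of y] that(1) by (auto simp: dist_norm)
      then show "y \<in> (\<lambda>y. y - v) ` U" by (intro image_eqI[of _ _ "y + v"]) auto
    qed
    ultimately have "convex hull B \<subseteq> (\<lambda>y. y - v) ` U" by (intro hull_minimal)
    with that(2) show ?thesis by auto
  qed
  from this[of "_ - _"] have "ball x d \<subseteq> U" if "x \<in> convex hull B" for x
    using that by (force simp: dist_norm norm_minus_commute)
  with assms d(1) show ?thesis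
    by (auto simp: U_bounded_iff bounded_convex_hull)
qed

subsection \<open>Derivatives along weakly $p$-Cauchy sequences\<close>

lemma C1u_has_derivative:
  "f \<in> C1u U \<Longrightarrow> x \<in> U \<Longrightarrow> (f has_derivative blinfun_apply (fderiv f x)) (at x)"
  by (simp add: C1u_def has_derivative_fderiv)

lemma onorm_blinfun_diff: "onorm (blinfun_apply A - blinfun_apply B) = norm (A - B)"
  by (simp add: norm_blinfun.rep_eq minus_blinfun.rep_eq fun_diff_def)

lemma fderiv_linearization_bound:
  assumes "f \<in> C1u U" "closed_segment a b \<subseteq> U"
    and le: "\<And>z. z \<in> closed_segment a b \<Longrightarrow> norm (fderiv f z - fderiv f a) \<le> e"
  shows "norm (f b - f a - fderiv f a (b - a)) \<le> norm (b - a) * e"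
proof (rule differentiable_bound_linearization[where S = "closed_segment a b" and f' = "\<lambda>x. blinfun_apply (fderiv f x)"])
  show "a + t *\<^sub>R (b - a) \<in> closed_segment a b" if "t \<in> {0..1}" for t
    using that by (auto simp: in_segment algebra_simps intro!: exI[of _ t])
  show "(f has_derivative fderiv f x) (at x within closed_segment a b)" if "x \<in> closed_segment a b" for x
    using assms(1,2) that by (blast intro: has_derivative_at_withinI C1u_has_derivative)
  show "onorm (blinfun_apply (fderiv f x) - blinfun_apply (fderiv f a)) \<le> e" if "x \<in> closed_segment a b" for x
    using le[OF that] unfolding onorm_blinfun_diff .
qed (rule ends_in_segment)

text \<open>Only the derivative in the direction \<open>b - a\<close> is bounded, not its operator
  norm, since condition (iv) controls no more than that. Hence the restriction to a function of one
  real variable.\<close>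

lemma fderiv_mean_value_bound:
  assumes "f \<in> C1u U" "closed_segment a b \<subseteq> U"
    and le: "\<And>t. t \<in> {0..1} \<Longrightarrow> norm (fderiv f (a + t *\<^sub>R (b - a)) (b - a)) \<le> e"
  shows "norm (f b - f a) \<le> e"
proof -
  let ?g = "\<lambda>t. a + t *\<^sub>R (b - a)"
  have seg: "?g t \<in> U" if "t \<in> {0..1}" for t
    using that assms(2) by (intro subsetD[OF assms(2)]) (auto simp: in_segment algebra_simps intro!: exI[of _ t])
  have "norm (f (?g 1) - f (?g 0)) \<le> e * norm (1 - 0 :: real)"
  proof (rule differentiable_bound[where S = "{0..1}" and f' = "\<lambda>t s. fderiv f (?g t) (s *\<^sub>R (b - a))"])
    fix t :: real assume t: "t \<in> {0..1}"
    have "(?g has_derivative (\<lambda>s. s *\<^sub>R (b - a))) (at t)"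
      by (auto intro!: derivative_eq_intros)
    from has_derivative_compose[OF this C1u_has_derivative[OF assms(1) seg[OF t]]]
    show "((\<lambda>t. f (?g t)) has_derivative (\<lambda>s. fderiv f (?g t) (s *\<^sub>R (b - a)))) (at t within {0..1})"
      by (rule has_derivative_at_withinI)
    show "onorm (\<lambda>s. fderiv f (?g t) (s *\<^sub>R (b - a))) \<le> e"
      using le[OF t]
      by (intro onorm_le) (simp add: blinfun.scaleR_right mult.commute[of e] mult_left_mono)
  qed auto
  then show ?thesis by simp
qed

lemma convergent_uniform_approx:
  fixes a :: "nat \<Rightarrow> 'b::banach"
  assumes "\<And>e. 0 < e \<Longrightarrow> \<exists>g. convergent g \<and> (\<forall>n. norm (a n - g n) \<le> e)"
  shows "convergent a"
  unfolding Cauchy_convergent_iff[symmetric]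
proof (rule metric_CauchyI)
  fix e :: real assume e: "0 < e"
  then obtain g where g: "convergent g" "\<And>n. norm (a n - g n) \<le> e / 4"
    using assms[of "e / 4"] by auto
  then obtain N where N: "\<And>m n. N \<le> m \<Longrightarrow> N \<le> n \<Longrightarrow> dist (g m) (g n) < e / 4"
    using e metric_CauchyD[of g "e / 4"] by (auto simp: Cauchy_convergent_iff)
  have "dist (a m) (a n) < e" if "N \<le> m" "N \<le> n" for m n
    using N[OF that] g(2)[of m] g(2)[of n] e
      dist_triangle[of "a m" "a n" "g m"] dist_triangle[of "g m" "a n" "g n"]
    by (simp add: dist_norm norm_minus_commute)
  then show "\<exists>M. \<forall>m\<ge>M. \<forall>n\<ge>M. dist (a m) (a n) < e" by blast
qed

section \<open>Weak p-sequential continuity in terms of the derivative\<close>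

lemma Cwsc_imp_fderiv_convergent:
  fixes f :: "'a::banach \<Rightarrow> 'b::banach"
  assumes U: "open U" and p: "1 \<le> p" and f: "f \<in> C1u U" "f \<in> Cwsc p U"
    and x: "U_bounded U (range x)" "weakly_p_Cauchy p x" and h: "weakly_p_Cauchy p h"
  shows "convergent (\<lambda>n. fderiv f (x n) (h n))"
proof (rule convergent_uniform_approx)
  fix e :: real assume e: "0 < e"
  obtain M where M: "0 < M" "\<And>n. norm (h n) \<le> M"
    using weakly_p_Cauchy_bounded[OF p h] by (auto simp: bounded_pos)
  obtain d where d: "0 < d" "U_bounded U (\<Union>z\<in>range x. cball z d)"
    using U_bounded_enlarge[OF U x(1)] .
  let ?D = "\<Union>z\<in>range x. cball z d"
  have "uniformly_continuous_on ?D (fderiv f)"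
    using f(1) d(2) by (auto simp: C1u_def)
  then obtain \<eta> where eta: "0 < \<eta>"
    "\<And>y z. y \<in> ?D \<Longrightarrow> z \<in> ?D \<Longrightarrow> dist z y < \<eta> \<Longrightarrow> dist (fderiv f z) (fderiv f y) < e / M"
    using e M(1) unfolding uniformly_continuous_on_def by (metis divide_pos_pos)
  \<comment> \<open>One step size for all \<open>n\<close>: since \<open>norm (h n)\<close> is at
    most \<open>M\<close>, the displaced points stay in \<open>?D\<close> and strictly within
    \<open>\<eta>\<close> of \<open>x n\<close>.\<close>
  define t where "t = min d (\<eta> / 2) / M"
  have t: "0 < t" "t * M \<le> d" "t * M < \<eta>"
    using d(1) eta(1) M(1) by (auto simp: t_def)
  define y where "y n = x n + t *\<^sub>R h n" for n
  have dist_y: "norm (y n - x n) \<le> t * M" for n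
    using t(1) M(2)[of n] by (simp add: y_def)
  have seg: "z \<in> cball (x n) d \<and> dist z (x n) < \<eta>" if "z \<in> closed_segment (x n) (y n)" for z n
    using segment_bound(1)[OF that] dist_y[of n] t by (auto simp: dist_norm norm_minus_commute)
  have y_D: "range y \<subseteq> ?D"
    using seg[OF ends_in_segment(2)] by blast
  have "weakly_p_Cauchy p y"
    unfolding y_def using p x(2) h by (intro weakly_p_Cauchy_add weakly_p_Cauchy_scaleR) auto
  then have "convergent (\<lambda>n. f (y n))"
    using f(2) U_bounded_subset[OF U d(2) y_D] by (auto simp: Cwsc_def)
  moreover have "convergent (\<lambda>n. f (x n))"
    using f(2) x by (auto simp: Cwsc_def)
  ultimately have "convergent (\<lambda>n. (1 / t) *\<^sub>R (f (y n) - f (x n)))"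
    by (intro bounded_linear.convergent[OF bounded_linear_scaleR_right] convergent_diff)
  moreover have "norm (fderiv f (x n) (h n) - (1 / t) *\<^sub>R (f (y n) - f (x n))) \<le> e" for n
  proof -
    have "norm (f (y n) - f (x n) - fderiv f (x n) (y n - x n)) \<le> norm (y n - x n) * (e / M)"
    proof (rule fderiv_linearization_bound[OF f(1)])
      show "closed_segment (x n) (y n) \<subseteq> U"
        using seg U_bounded_imp_subset[OF d(2)] by blast
      fix z assume "z \<in> closed_segment (x n) (y n)"
      from seg[OF this] have "z \<in> ?D" "dist z (x n) < \<eta>" by blast+
      moreover have "x n \<in> ?D" using d(1) by (intro UN_I[of "x n"]) auto
      ultimately have "dist (fderiv f z) (fderiv f (x n)) < e / M" by (intro eta(2))
      then show "norm (fderiv f z - fderiv f (x n)) \<le> e / M" by (simp add: dist_norm)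
    qed
    also have "\<dots> \<le> t * M * (e / M)"
      using dist_y[of n] e M(1) by (intro mult_right_mono) auto
    also have "\<dots> = t * e" using M(1) by simp
    \<comment> \<open>The linearization error is \<open>- t\<close> times the error of the
      difference quotient, so the bound \<open>t * e\<close> becomes \<open>e\<close> after division
      by \<open>t\<close>.\<close>
    also have "f (y n) - f (x n) - fderiv f (x n) (y n - x n) =
        (- t) *\<^sub>R (fderiv f (x n) (h n) - (1 / t) *\<^sub>R (f (y n) - f (x n)))"
      using t(1) by (simp add: y_def blinfun.scaleR_right algebra_simps)
    finally show ?thesis using t(1) by simp
  qed
  ultimately show "\<exists>g. convergent g \<and> (\<forall>n. norm (fderiv f (x n) (h n) - g n) \<le> e)"
    by blast
qed

lemma fderiv_convergent_imp_tendsto_zero: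
  assumes U: "open U" and p: "0 \<le> p"
    and conv: "\<And>x h. U_bounded U (range x) \<Longrightarrow> weakly_p_Cauchy p x \<Longrightarrow> weakly_p_Cauchy p h \<Longrightarrow>
      convergent (\<lambda>n. fderiv f (x n) (h n))"
    and x: "U_bounded U (range x)" "weakly_p_Cauchy p x" and h: "weakly_p_summable p h"
  shows "(\<lambda>n. fderiv f (x n) (h n)) \<longlonglongrightarrow> 0"
proof -
  \<comment> \<open>Paired with \<open>x (n div 2)\<close>, index \<open>2 * n\<close> yields 0 and
    index \<open>2 * n + 1\<close> yields the original \<open>n\<close>-th value; a common limit
    must then be 0.\<close>
  define k where "k n = (if even n then 0 else h (n div 2))" for n
  have "weakly_p_summable p k"
    by (rule weakly_p_summable_even_odd) (simp_all add: k_def h)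
  then have "convergent (\<lambda>n. fderiv f (x (n div 2)) (k n))"
    by (intro conv weakly_p_Cauchy_div_2[OF x(2)] weakly_p_summable_imp_Cauchy[OF p]
        U_bounded_subset[OF U x(1)]) auto
  then obtain l where l: "(\<lambda>n. fderiv f (x (n div 2)) (k n)) \<longlonglongrightarrow> l"
    by (auto simp: convergent_def)
  have "(\<lambda>n. fderiv f (x (2 * n div 2)) (k (2 * n))) \<longlonglongrightarrow> l"
    using LIMSEQ_subseq_LIMSEQ[OF l, of "\<lambda>n. 2 * n"] by (simp add: strict_mono_def o_def)
  then have "l = 0"
    by (simp add: k_def blinfun.zero_right LIMSEQ_const_iff)
  moreover have "(\<lambda>n. fderiv f (x ((2 * n + 1) div 2)) (k (2 * n + 1))) \<longlonglongrightarrow> l"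
    using LIMSEQ_subseq_LIMSEQ[OF l, of "\<lambda>n. 2 * n + 1"] by (simp add: strict_mono_def o_def)
  ultimately show ?thesis by (simp add: k_def)
qed

lemma fderiv_tendsto_zero_imp_Cwsc:
  fixes f :: "'a::banach \<Rightarrow> 'b::banach"
  assumes U: "open U" "convex U" and p: "0 \<le> p" and f: "f \<in> C1u U"
    and lim: "\<And>x h. U_bounded U (range x) \<Longrightarrow> weakly_p_Cauchy p x \<Longrightarrow> weakly_p_summable p h \<Longrightarrow>
      (\<lambda>n. fderiv f (x n) (h n)) \<longlonglongrightarrow> 0"
  shows "f \<in> Cwsc p U"
  unfolding Cwsc_def mem_Collect_eq
proof (intro allI impI, rule ccontr)
  fix x :: "nat \<Rightarrow> 'a"
  assume x: "U_bounded U (range x)" "weakly_p_Cauchy p x" and "\<not> convergent (\<lambda>n. f (x n))"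
  then obtain e where e: "0 < e" "\<And>N. \<exists>m\<ge>N. \<exists>n\<ge>N. e \<le> dist (f (x m)) (f (x n))"
    unfolding Cauchy_convergent_iff[symmetric] Cauchy_def by (meson not_less)
  \<comment> \<open>Both coordinates must increase strictly, as the definition of weakly
    \<open>p\<close>-Cauchy compares two strictly increasing index sequences.\<close>
  have "\<exists>s. \<forall>k. (case s k of (m, n) \<Rightarrow> e \<le> dist (f (x m)) (f (x n))) \<and>
      (fst (s k) < fst (s (Suc k)) \<and> snd (s k) < snd (s (Suc k)))"
  proof (rule dependent_nat_choice)
    show "\<exists>s. case s of (m, n) \<Rightarrow> e \<le> dist (f (x m)) (f (x n))"
      using e(2)[of 0] by auto
    fix s :: "nat \<times> nat"
    from e(2)[of "Suc (fst s + snd s)"] obtain m n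
      where "Suc (fst s + snd s) \<le> m" "Suc (fst s + snd s) \<le> n" "e \<le> dist (f (x m)) (f (x n))"
      by blast
    then show "\<exists>s'. (case s' of (m, n) \<Rightarrow> e \<le> dist (f (x m)) (f (x n))) \<and>
        (fst s < fst s' \<and> snd s < snd s')"
      by (intro exI[of _ "(m, n)"]) auto
  qed
  then obtain s where s: "e \<le> dist (f (x (fst (s k)))) (f (x (snd (s k))))"
    "fst (s k) < fst (s (Suc k))" "snd (s k) < snd (s (Suc k))" for k
    by (auto simp: case_prod_beta)
  define m n where "m k = fst (s k)" and "n k = snd (s k)" for k
  have mono: "strict_mono m" "strict_mono n"
    using s(2,3) by (auto simp: m_def n_def strict_mono_Suc_iff)
  define h where "h k = x (m k) - x (n k)" for k
  have h: "weakly_p_summable p h"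
    unfolding h_def using x(2) mono by (rule weakly_p_Cauchy_diff_summable)
  \<comment> \<open>The intermediate points lie on segments between terms, so they leave
    \<open>range x\<close> but not its convex hull.\<close>
  have hull: "U_bounded U (convex hull range x)"
    using U x(1) by (rule U_bounded_convex_hull)
  have seg: "closed_segment (x i) (x j) \<subseteq> convex hull range x" for i j
    by (simp add: segment_convex_hull hull_mono)
  \<comment> \<open>Otherwise the mean value inequality would bound the increment of
    \<open>f\<close> by \<open>e / 2\<close>, although it is at least \<open>e\<close>.\<close>
  have "\<exists>t\<in>{0..1}. e / 2 < norm (fderiv f (x (n k) + t *\<^sub>R h k) (h k))" for k
  proof (rule ccontr)
    assume "\<not> ?thesis"
    moreover have "closed_segment (x (n k)) (x (m k)) \<subseteq> U"
      using seg U_bounded_imp_subset[OF hull] by (rule order_trans)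
    ultimately have "norm (f (x (m k)) - f (x (n k))) \<le> e / 2"
      by (intro fderiv_mean_value_bound[OF f]) (auto simp: h_def not_less)
    with s(1)[of k] e(1) show False by (simp add: m_def n_def dist_norm)
  qed
  then obtain t where t: "t k \<in> {0..1}" "e / 2 < norm (fderiv f (x (n k) + t k *\<^sub>R h k) (h k))" for k
    by metis
  have "x (n k) + t k *\<^sub>R h k \<in> closed_segment (x (n k)) (x (m k))" for k
    using t(1)[of k] by (auto simp: h_def in_segment algebra_simps intro!: exI[of _ "t k"])
  then have "U_bounded U (range (\<lambda>k. x (n k) + t k *\<^sub>R h k))"
    using seg by (intro U_bounded_subset[OF U(1) hull]) blast
  moreover have "weakly_p_summable p (\<lambda>k. t k *\<^sub>R h k)"
    using p h t(1) by (intro weakly_p_summable_scaleR[where C = 1]) auto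
  then have "weakly_p_Cauchy p (\<lambda>k. x (n k) + t k *\<^sub>R h k)"
    by (intro weakly_p_Cauchy_add weakly_p_Cauchy_subseq[OF x(2) mono(2)]
        weakly_p_summable_imp_Cauchy p)
  ultimately have "(\<lambda>k. fderiv f (x (n k) + t k *\<^sub>R h k) (h k)) \<longlonglongrightarrow> 0"
    using h by (rule lim)
  then obtain k where "norm (fderiv f (x (n k) + t k *\<^sub>R h k) (h k)) < e / 2"
    using e(1) LIMSEQ_D[of _ 0 "e / 2"] by force
  with t(2)[of k] show False by simp
qed

section \<open>Uniform p-convergence\<close>

lemma ennreal_tendsto_zeroI:
  fixes g :: "nat \<Rightarrow> ennreal"
  assumes "\<And>e. 0 < e \<Longrightarrow> eventually (\<lambda>n. g n \<le> ennreal e) sequentially"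
  shows "g \<longlonglongrightarrow> 0"
proof (rule order_tendstoI)
  fix a :: ennreal assume "0 < a"
  \<comment> \<open>The bound \<open>a\<close> may be infinite; a value strictly below it is finite
    and so comes from a real \<open>e\<close>.\<close>
  then obtain b where b: "0 < b" "b < a" using dense by blast
  then obtain e where "b = ennreal e" "0 \<le> e" by (cases b) auto
  with b have "0 < e" "ennreal e < a" by (auto simp: ennreal_less_zero_iff)
  with assms[of e] show "eventually (\<lambda>n. g n < a) sequentially"
    by (auto elim!: eventually_mono)
qed simp

lemma fderiv_tendsto_zero_imp_uniformly_p_convergent:
  assumes U: "open U"
    and lim: "\<And>x h. U_bounded U (range x) \<Longrightarrow> weakly_p_Cauchy p x \<Longrightarrow> weakly_p_summable p h \<Longrightarrow>
      (\<lambda>n. fderiv f (x n) (h n)) \<longlonglongrightarrow> 0"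
    and A: "U_bounded U A" "weakly_p_precompact p A"
  shows "uniformly_p_convergent p (fderiv f ` A)"
  unfolding uniformly_p_convergent_def
proof (intro allI impI ennreal_tendsto_zeroI, rule ccontr)
  fix h and e :: real
  assume h: "weakly_p_summable p h" and e: "0 < e"
    and nev: "\<not> (\<forall>\<^sub>F n in sequentially. (SUP T\<in>fderiv f ` A. ennreal (norm (blinfun_apply T (h n)))) \<le> ennreal e)"
  obtain r :: "nat \<Rightarrow> nat" where r: "strict_mono r"
    "\<not> (SUP T\<in>fderiv f ` A. ennreal (norm (blinfun_apply T (h (r k))))) \<le> ennreal e" for k
    using not_eventually_sequentiallyD[OF nev] by blast
  have "\<exists>a\<in>A. e < norm (fderiv f a (h (r k)))" for k
  proof (rule ccontr)
    assume "\<not> ?thesis"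
    then have "(SUP T\<in>fderiv f ` A. ennreal (norm (blinfun_apply T (h (r k))))) \<le> ennreal e"
      by (intro SUP_least) (auto simp: not_less ennreal_leI)
    with r(2) show False by blast
  qed
  then obtain a where a: "a k \<in> A" "e < norm (fderiv f (a k) (h (r k)))" for k
    by metis
  then obtain q :: "nat \<Rightarrow> nat" where q: "strict_mono q" "weakly_p_Cauchy p (\<lambda>k. a (q k))"
    using A(2) unfolding weakly_p_precompact_def o_def by blast
  \<comment> \<open>The vectors are reindexed along with the points \<open>a (q k)\<close>, so that
    (iv) applies to matching pairs.\<close>
  have "inj (\<lambda>k. r (q k))"
    by (rule strict_mono_imp_inj_on[OF strict_mono_compose[OF r(1) q(1)]])
  from weakly_p_summable_reindex[OF h this] have "weakly_p_summable p (\<lambda>k. h (r (q k)))" .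
  moreover have "U_bounded U (range (\<lambda>k. a (q k)))"
    using a(1) by (intro U_bounded_subset[OF U A(1)]) blast
  ultimately have "(\<lambda>k. fderiv f (a (q k)) (h (r (q k)))) \<longlonglongrightarrow> 0"
    by (intro lim q(2))
  then obtain k where "norm (fderiv f (a (q k)) (h (r (q k)))) < e"
    using e LIMSEQ_D[of _ 0 e] by force
  with a(2)[of "q k"] show False by simp
qed

text \<open>The diagonal term \<open>m = n\<close> is one of those in the supremum.\<close>

lemma SUP_tendsto_zero_imp_tendsto_zero:
  fixes T :: "nat \<Rightarrow> 'a::real_normed_vector \<Rightarrow>\<^sub>L 'b::real_normed_vector"
  assumes "(\<lambda>n. SUP m. ennreal (norm (T m (h n)))) \<longlonglongrightarrow> 0"
  shows "(\<lambda>n. T n (h n)) \<longlonglongrightarrow> 0"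
proof -
  have "(\<lambda>n. ennreal (norm (T n (h n)))) \<longlonglongrightarrow> 0"
    by (rule tendsto_sandwich[OF _ _ tendsto_const assms])
      (auto intro!: always_eventually SUP_upper)
  then show ?thesis
    by (simp add: ennreal_tendsto_0_iff tendsto_norm_zero_iff)
qed

theorem theorem3p6:
  fixes U :: "'a::banach set"
    and f :: "'a \<Rightarrow> 'b::banach"
    and p :: real
  assumes "open U" and "convex U" and "1 \<le> p" and "f \<in> C1u U"
  shows
    "(f \<in> Cwsc p U \<longleftrightarrow>
       (\<forall>x h. U_bounded U (range x) \<longrightarrow> weakly_p_Cauchy p x \<longrightarrow> weakly_p_Cauchy p h \<longrightarrow>
          convergent (\<lambda>n :: nat. blinfun_apply (fderiv f (x n)) (h n)))) \<and>
     (f \<in> Cwsc p U \<longleftrightarrow>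
       (\<forall>x h. U_bounded U (range x) \<longrightarrow> weakly_p_Cauchy p x \<longrightarrow> weakly_p_summable p h \<longrightarrow>
          (\<lambda>n :: nat. SUP m :: nat. ennreal (norm (blinfun_apply (fderiv f (x m)) (h n))))
            \<longlonglongrightarrow> 0)) \<and>
     (f \<in> Cwsc p U \<longleftrightarrow>
       (\<forall>x h. U_bounded U (range x) \<longrightarrow> weakly_p_Cauchy p x \<longrightarrow> weakly_p_summable p h \<longrightarrow>
          (\<lambda>n :: nat. blinfun_apply (fderiv f (x n)) (h n)) \<longlonglongrightarrow> 0)) \<and>
     (f \<in> Cwsc p U \<longleftrightarrow>
       (\<forall>A. U_bounded U A \<longrightarrow> weakly_p_precompact p A \<longrightarrow>
          uniformly_p_convergent p (fderiv f ` A)))"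
    (is "(?i \<longleftrightarrow> ?ii) \<and> (?i \<longleftrightarrow> ?iii) \<and> (?i \<longleftrightarrow> ?iv) \<and> (?i \<longleftrightarrow> ?v)")
proof -
  have p: "0 \<le> p" using assms(3) by simp
  have 1: "?i \<Longrightarrow> ?ii"
    using Cwsc_imp_fderiv_convergent[OF assms(1,3,4)] by blast
  have 2: "?ii \<Longrightarrow> ?iv"
    using fderiv_convergent_imp_tendsto_zero[OF assms(1) p, of f] by blast
  have 3: "?iv \<Longrightarrow> ?i"
    using fderiv_tendsto_zero_imp_Cwsc[OF assms(1,2) p assms(4)] by blast
  have 4: "?iv \<Longrightarrow> ?v"
    using fderiv_tendsto_zero_imp_uniformly_p_convergent[OF assms(1), of p f] by blast
  have 5: ?iii if ?v
  proof (intro allI impI)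
    fix x h :: "nat \<Rightarrow> 'a"
    assume "U_bounded U (range x)" "weakly_p_Cauchy p x" and h: "weakly_p_summable p h"
    with that have "uniformly_p_convergent p (fderiv f ` range x)"
      by (simp add: weakly_p_Cauchy_range_precompact)
    with h show "(\<lambda>n. SUP m. ennreal (norm (fderiv f (x m) (h n)))) \<longlonglongrightarrow> 0"
      by (auto simp: uniformly_p_convergent_def image_image)
  qed
  have 6: "?iii \<Longrightarrow> ?iv"
    using SUP_tendsto_zero_imp_tendsto_zero[of "\<lambda>m. fderiv f (_ m)"] by blast
  \<comment> \<open>Two cycles meet in (iv): one runs through (i) and (ii), the other through (v)
    and (iii).\<close>
  from 1 2 3 4 5 6 show ?thesis by argo
qed


end
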